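(* Let $0<\lambda<1$ and $0<q\le 1$, and let $T_1^q$ be a random variable with the discrete Mittag-Leffler distribution with parameters $q,\lambda$, i.e. $T_1^q$ takes values in $\{1,2,3,\dots\}$ and $P(T_1^q>t)=F_{q,-\lambda}(t)$ for all $t=1,2,\dots$. Then for every real $z$ with $-1\le z\le 1$, $$G^q(z):=E\big[z^{T_1^q}\big]=\frac{\lambda z}{(1-z)^q+\lambda}.$$
   Context: For $x\in\mathbb{R}\setminus\{0,-1,-2,\dots\}$ and $\alpha\in\mathbb{R}\setminus\{-1,-2,\dots\}$ with $x+\alpha\notin\{0,-1,-2,\dots\}$, the generalized binomial coefficient is $$\hat h_\alpha(x)=\frac{\Gamma(x+\alpha)}{\Gamma(\alpha+1)\,\Gamma(x)}.$$ For real $q>0$ the discrete Mittag-Leffler function is $$F_{q,\lambda}(t)=\sum_{m=0}^\infty \hat h_{qm}(t)\,\lambda^m ,$$ so that $F_{q,-\lambda}(t)=\sum_{m=0}^\infty \hat h_{qm}(t)\,(-\lambda)^m$. *)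

theory Defs
  imports "HOL-Probability.Probability"
begin

text \<open>
  Generalized binomial coefficient. It is meant for \<open>x\<close> and \<open>x + \<alpha>\<close> outside
  \<open>{0, -1, -2, \<dots>}\<close> and \<open>\<alpha>\<close> outside \<open>{-1, -2, \<dots>}\<close>; elsewhere the value is an
  artefact of \<open>Gamma\<close> being \<open>0\<close> at its poles.
\<close>

definition gen_binom :: "real \<Rightarrow> real \<Rightarrow> real" where
  "gen_binom \<alpha> x = Gamma (x + \<alpha>) / (Gamma (\<alpha> + 1) * Gamma x)"

definition discrete_ML :: "real \<Rightarrow> real \<Rightarrow> real \<Rightarrow> real" where
  "discrete_ML q l t = (\<Sum>m. gen_binom (q * real m) t * l ^ m)"

text \<open>
  The sign of the parameter is built in: the tail probabilities are the values of the
  Mittag-Leffler function with parameter \<open>- l\<close>. The formula for the tail is required for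
  \<open>t \<ge> 1\<close> only; at \<open>t = 0\<close>, where \<open>P(T > 0) = 1\<close>, the function \<open>gen_binom\<close> has a pole
  in its denominator.
\<close>

definition (in prob_space) discrete_ML_distributed ::
    "real \<Rightarrow> real \<Rightarrow> ('a \<Rightarrow> nat) \<Rightarrow> bool" where
  "discrete_ML_distributed q l T \<longleftrightarrow>
     random_variable (count_space {1..}) T \<and>
     (\<forall>t\<ge>1. prob {\<omega> \<in> space M. T \<omega> > t} = discrete_ML q (- l) (real t))"

end

theory Submission 
  imports Defs "HOL-Complex_Analysis.Cauchy_Integral_Formula"
begin

text \<open>
  For \<open>\<bar>z\<bar> < 1\<close> one has \<open>E (z ^ T) = 1 - (1 - z) * (\<Sum>t. P (T > t) * z ^ t)\<close>.
  If moreover \<open>l < (1 - \<bar>z\<bar>) powr q\<close>, the double series obtained by inserting the Mittag-Leffler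
  tail converges absolutely; summing over \<open>t\<close> first by the binomial series leaves a geometric
  series in \<open>m\<close>. The resulting identity, multiplied by \<open>(1 - z) powr q + l\<close>, relates power series
  with radius of convergence at least \<open>1\<close>, so it extends from a neighbourhood of \<open>0\<close> to the open
  interval; the point \<open>z = -1\<close> follows by dominated convergence.
\<close>

section \<open>Generalized binomial coefficients and the binomial series\<close>

lemma gen_binom_Suc:
  assumes "a > -1"
  shows "gen_binom a (real (Suc n)) = pochhammer (a + 1) n / fact n"
proof -
  have "a + 1 \<notin> \<int>\<^sub>\<le>\<^sub>0"
    using assms by (auto elim!: nonpos_Ints_cases)
  then show ?thesis
    using pochhammer_Gamma[of "a + 1" n] Gamma_fact[of n, where 'a = real]
    by (simp add: gen_binom_def add_ac)
qed

lemma gen_binom_Suc_nonneg: "a > -1 \<Longrightarrow> gen_binom a (real (Suc n)) \<ge> 0"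
  by (simp add: gen_binom_Suc pochhammer_nonneg del: of_nat_Suc)

text \<open>Reflection turns the coefficient into \<open>- (a + 1) gchoose n\<close> up to the sign
  \<open>(- 1) ^ n\<close>, so this is the binomial series at \<open>- z\<close>.\<close>

lemma gen_binom_Suc_sums:
  assumes "a > -1" and "\<bar>z\<bar> < 1"
  shows "(\<lambda>n. gen_binom a (real (Suc n)) * z ^ n) sums (1 - z) powr (- (a + 1))"
proof -
  have "(- (a + 1) gchoose n) * (- z) ^ n = gen_binom a (real (Suc n)) * z ^ n" for n
    unfolding gen_binom_Suc[OF assms(1)] gbinomial_pochhammer
    by (simp add: power_mult_distrib[symmetric] add_ac flip: power_minus)
  then show ?thesis
    using gen_binomial_real[of "- z" "- (a + 1)"] assms(2) by simp
qed

text \<open>The coefficients are nonnegative, so the series at \<open>\<bar>z\<bar>\<close> yields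
  absolute summability at \<open>z\<close>.\<close>

lemma gen_binom_Suc_has_sum:
  assumes "a > -1" and "\<bar>z\<bar> < 1"
  shows "((\<lambda>n. gen_binom a (real (Suc n)) * z ^ n) has_sum (1 - z) powr (- (a + 1))) UNIV"
proof (rule norm_summable_imp_has_sum[OF _ gen_binom_Suc_sums[OF assms]])
  show "summable (\<lambda>n. norm (gen_binom a (real (Suc n)) * z ^ n))"
    using gen_binom_Suc_sums[of a "\<bar>z\<bar>"] assms gen_binom_Suc_nonneg[OF assms(1)]
    by (simp add: abs_mult power_abs sums_iff del: of_nat_Suc)
qed

section \<open>The double series for the tail generating function near zero\<close>

lemma geometric_powr_has_sum:
  fixes q x :: real
  assumes "0 < y" and "\<bar>x\<bar> < y powr q"
  shows "((\<lambda>m. x ^ m * y powr (- (q * real m + 1))) has_sum (y powr (q - 1) / (y powr q - x))) UNIV"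
proof -
  \<comment> \<open>The common ratio; the bound on \<open>x\<close> says exactly that its modulus is
    below 1.\<close>
  let ?r = "x * y powr (- q)"
  have r: "norm ?r < 1"
    using assms by (simp add: abs_mult powr_minus field_simps)
  have terms: "x ^ m * y powr (- (q * real m + 1)) = inverse y * ?r ^ m" for m
    using assms(1)
    by (simp add: power_mult_distrib powr_diff powr_minus powr_powr[symmetric] powr_realpow field_simps)
  have total: "inverse y * (1 / (1 - ?r)) = y powr (q - 1) / (y powr q - x)"
    using assms by (simp add: powr_minus powr_diff divide_simps)
  have "((\<lambda>m. ?r ^ m) has_sum (1 / (1 - ?r))) UNIV"
  proof (rule norm_summable_imp_has_sum)
    show "summable (\<lambda>m. norm (?r ^ m))"
      unfolding norm_power using r by (intro summable_geometric) simp
  qed (rule geometric_sums[OF r])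
  from has_sum_cmult_right[OF this, of "inverse y"] show ?thesis
    unfolding terms total .
qed

text \<open>Fubini for sums: after summing over \<open>n\<close>, the absolute values form a
  geometric series in \<open>m\<close> with ratio
  \<open>\<bar>l\<bar> / (1 - \<bar>z\<bar>) powr q\<close>, which \<open>small\<close> keeps below
  1.\<close>

lemma discrete_ML_generating_function:
  fixes q l z :: real
  assumes "0 < q" and "\<bar>z\<bar> < 1" and small: "\<bar>l\<bar> < (1 - \<bar>z\<bar>) powr q"
  shows "(\<lambda>n. discrete_ML q (- l) (real (Suc n)) * z ^ n) sums
           ((1 - z) powr (q - 1) / ((1 - z) powr q + l))"
proof -
  \<comment> \<open>The parameters \<open>w\<close> and \<open>k\<close> let one family serve both
    as the signed series (\<open>z\<close>, \<open>- l\<close>) and as its majorant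
    (\<open>\<bar>z\<bar>\<close>, \<open>\<bar>l\<bar>\<close>).\<close>
  define f where "f w k = (\<lambda>(m, n). k ^ m * (gen_binom (q * real m) (real (Suc n)) * w ^ n))"
    for w k :: real
  let ?g = "\<lambda>w k m. k ^ m * (1 - w) powr (- (q * real m + 1))"
  have qm: "q * real m > -1" for m
    by (rule order.strict_trans2[of _ 0]) (use assms(1) in auto)
  have inner: "((\<lambda>n. f w k (m, n)) has_sum ?g w k m) UNIV" if "\<bar>w\<bar> < 1" for w k m
    unfolding f_def prod.case by (intro has_sum_cmult_right gen_binom_Suc_has_sum qm that)
  have "f \<bar>z\<bar> \<bar>l\<bar> summable_on (UNIV \<times> UNIV)"
  proof (rule summable_on_SigmaI)
    show "?g \<bar>z\<bar> \<bar>l\<bar> summable_on UNIV"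
      using geometric_powr_has_sum[of "1 - \<bar>z\<bar>" "\<bar>l\<bar>" q] assms by (auto simp: summable_on_def)
  qed (use inner[of "\<bar>z\<bar>"] assms gen_binom_Suc_nonneg[OF qm] in \<open>auto simp: f_def\<close>)
  moreover have "norm (f z l' p) = f \<bar>z\<bar> \<bar>l'\<bar> p" for p l'
    using gen_binom_Suc_nonneg[OF qm]
    by (auto simp: f_def abs_mult power_abs split: prod.split simp del: of_nat_Suc)
  ultimately have "(\<lambda>p. norm (f z (- l) p)) summable_on (UNIV \<times> UNIV)"
    by simp
  then have summ: "f z (- l) summable_on (UNIV \<times> UNIV)"
    by (rule abs_summable_summable)
  have "\<bar>- l\<bar> < (1 - z) powr q"
    using order.strict_trans2[OF small powr_mono2[of q "1 - \<bar>z\<bar>" "1 - z"]] assms(1,2) by auto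
  then have "(?g z (- l) has_sum ((1 - z) powr (q - 1) / ((1 - z) powr q + l))) UNIV"
    using geometric_powr_has_sum[of "1 - z" "- l" q] assms by auto
  then have "(f z (- l) has_sum ((1 - z) powr (q - 1) / ((1 - z) powr q + l))) (UNIV \<times> UNIV)"
    using inner[OF assms(2)] summ by (intro has_sum_SigmaI[where g = "?g z (- l)"])
  then have "((\<lambda>(n, m). f z (- l) (m, n)) has_sum ((1 - z) powr (q - 1) / ((1 - z) powr q + l)))
          (UNIV \<times> UNIV)"
    by (rule has_sum_swap[THEN iffD1])
  \<comment> \<open>With the order swapped, the inner unordered sum over \<open>m\<close> has to be
    matched with the \<open>suminf\<close> that defines \<open>discrete_ML\<close>.\<close>
  moreover have "((\<lambda>m. f z (- l) (m, n)) has_sum discrete_ML q (- l) (real (Suc n)) * z ^ n) UNIV" for n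
  proof -
    let ?h = "\<lambda>m. gen_binom (q * real m) (real (Suc n)) * (- l) ^ m"
    have eq: "f z (- l) (m, n) = ?h m * z ^ n" for m
      by (simp add: f_def)
    have "(\<lambda>m. f z (- l) (m, n)) summable_on UNIV"
      using summable_on_SigmaD1[of "\<lambda>n m. f z (- l) (m, n)" UNIV "\<lambda>_. UNIV" n]
        summable_on_swap[THEN iffD1, OF summ] by simp
    then have hs: "((\<lambda>m. ?h m * z ^ n) has_sum (\<Sum>\<^sub>\<infinity>m. ?h m * z ^ n)) UNIV"
      unfolding eq by (rule has_sum_infsum)
    then have s: "(\<lambda>m. ?h m * z ^ n) sums (\<Sum>\<^sub>\<infinity>m. ?h m * z ^ n)"
      by (rule has_sum_imp_sums)
    have "(\<Sum>\<^sub>\<infinity>m. ?h m * z ^ n) = suminf ?h * z ^ n"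
    \<comment> \<open>Summability of \<open>?h\<close> follows by cancelling \<open>z ^ n\<close>;
      where that factor vanishes, both sides are 0.\<close>
    proof (cases "z ^ n = 0")
      case False
      have "summable (\<lambda>m. z ^ n * ?h m)"
        using sums_summable[OF s] by (simp only: mult.commute)
      then have "summable ?h"
        using False summable_cmult_iff[of "z ^ n" ?h] by blast
      then show ?thesis
        by (rule trans[OF sums_unique[OF s] suminf_mult2[symmetric]])
    next
      case True
      show ?thesis
        unfolding True by simp
    qed
    with hs show ?thesis
      unfolding eq discrete_ML_def by simp
  qed
  ultimately have "((\<lambda>n. discrete_ML q (- l) (real (Suc n)) * z ^ n) has_sum
           ((1 - z) powr (q - 1) / ((1 - z) powr q + l))) UNIV"
    by (rule has_sum_SigmaD[where f = "\<lambda>(n, m). f z (- l) (m, n)" and B = "\<lambda>_. UNIV", unfolded prod.case])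
  then show ?thesis
    by (rule has_sum_imp_sums)
qed

section \<open>Expectation of a power through tail probabilities\<close>

lemma (in prob_space) expectation_power_eq_tail_sum:
  fixes T :: "'a \<Rightarrow> nat" and z :: real
  assumes [measurable]: "random_variable (count_space UNIV) T" and "\<bar>z\<bar> < 1"
  shows "expectation (\<lambda>\<omega>. z ^ T \<omega>) = 1 - (1 - z) * (\<Sum>t. prob {\<omega> \<in> space M. T \<omega> > t} * z ^ t)"
proof -
  define A where "A t = {\<omega> \<in> space M. T \<omega> > t}" for t
  have [measurable]: "A t \<in> events" for t
    unfolding A_def by measurable
  let ?f = "\<lambda>t \<omega>. indicator (A t) \<omega> * z ^ t"
  have sm: "summable (\<lambda>t. \<bar>z\<bar> ^ t)"
    using assms(2) by simp
  have int: "integrable M (?f t)" for t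
    by (intro integrable_mult_left integrable_real_indicator) (auto simp: less_top[symmetric])
  \<comment> \<open>The indicator of \<open>A t\<close> cuts the geometric series off at
    \<open>T \<omega>\<close>. The majorant \<open>\<bar>z\<bar> ^ t\<close> then justifies
    exchanging sum and expectation.\<close>
  have ptw: "(\<Sum>t. ?f t \<omega>) = (\<Sum>t<T \<omega>. z ^ t)" if "\<omega> \<in> space M" for \<omega>
  proof -
    have "(\<Sum>t. ?f t \<omega>) = (\<Sum>t<T \<omega>. ?f t \<omega>)"
      using that by (intro suminf_finite) (auto simp: A_def)
    then show ?thesis
      using that by (simp add: A_def)
  qed
  have AEs: "AE \<omega> in M. summable (\<lambda>t. norm (?f t \<omega>))"
    by (intro AE_I2 summable_comparison_test[OF _ sm])
      (auto simp: abs_mult power_abs indicator_def intro!: exI[of _ 0])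
  have sI: "summable (\<lambda>t. \<integral>\<omega>. norm (?f t \<omega>) \<partial>M)"
    by (rule summable_comparison_test[OF _ sm])
      (auto simp: abs_mult power_abs intro!: exI[of _ 0] mult_left_le_one_le)
  have "expectation (\<lambda>\<omega>. \<Sum>t. ?f t \<omega>) = (\<Sum>t. expectation (?f t))"
    by (rule integral_suminf[OF int AEs sI])
  moreover have "integrable M (\<lambda>\<omega>. \<Sum>t. ?f t \<omega>)"
    by (rule integrable_suminf[OF int AEs sI])
  moreover have "expectation (\<lambda>\<omega>. z ^ T \<omega>) = expectation (\<lambda>\<omega>. 1 - (1 - z) * (\<Sum>t. ?f t \<omega>))"
  proof (rule Bochner_Integration.integral_cong)
    fix \<omega> assume "\<omega> \<in> space M"
    then show "z ^ T \<omega> = 1 - (1 - z) * (\<Sum>t. ?f t \<omega>)"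
      using one_diff_power_eq[of z "T \<omega>"] ptw by simp
  qed simp
  ultimately show ?thesis
    by (simp add: A_def prob_space)
qed

lemma measurable_count_space_mono:
  assumes "f \<in> measurable M (count_space A)" and "A \<subseteq> B"
  shows "f \<in> measurable M (count_space B)"
  using assms by (intro measurable_compose[OF assms(1), of "\<lambda>x. x"]) auto

section \<open>Power series on the open unit interval\<close>

lemma has_fps_expansion_zero_imp_eq_0:
  fixes F :: "'a :: {real_normed_field, banach} fps"
  assumes "(\<lambda>_. 0) has_fps_expansion F"
  shows "F = 0"
proof (rule ccontr)
  assume "F \<noteq> 0"
  then obtain m where m: "fps_nth F m \<noteq> 0"
    by (auto simp: fps_eq_iff)
  have ev: "eventually (\<lambda>z. eval_fps F z = 0) (nhds 0)" and rad: "fps_conv_radius F > 0"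
    using assms by (auto simp: has_fps_expansion_def)
  have ev0: "eval_fps F 0 = 0"
    using ev by (rule eventually_nhds_x_imp_x)
  \<comment> \<open>The constant coefficient is the value at 0, hence zero. A nonzero coefficient of
    positive index makes the zero at the origin isolated, against vanishing on a
    neighbourhood.\<close>
  then have "m > 0"
    using m by (intro gr0I) (auto simp: eval_fps_at_0)
  obtain r where r: "0 < r" "ereal r < fps_conv_radius F"
    using ereal_dense2[OF rad] by (auto simp: zero_ereal_def)
  obtain s where "0 < s" and s: "\<And>z. z \<in> cball 0 s - {0} \<Longrightarrow> eval_fps F z \<noteq> 0"
  proof (rule powser_0_nonzero[where \<xi> = 0 and f = "eval_fps F" and a = "fps_nth F", OF r(1) _ ev0 m \<open>m > 0\<close>])
    fix x :: 'a
    assume "norm (x - 0) < r"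
    then have "ereal (norm x) < fps_conv_radius F"
      by (intro order.strict_trans[OF _ r(2)]) simp
    then show "(\<lambda>n. fps_nth F n * (x - 0) ^ n) sums eval_fps F x"
      by (simp add: sums_eval_fps)
  qed blast
  have "eventually (\<lambda>z. z \<in> cball 0 s - {0}) (at (0 :: 'a))"
    using \<open>0 < s\<close> by (auto simp: eventually_at dist_commute intro!: exI[of _ s])
  moreover have "eventually (\<lambda>z. eval_fps F z = 0) (at 0)"
    using ev by (simp add: eventually_at_filter eventually_mono)
  ultimately have "eventually (\<lambda>_. False) (at (0 :: 'a))"
    by eventually_elim (use s in blast)
  then show False
    by simp
qed

lemma fps_conv_radius_ge_1I:
  fixes F :: "real fps"
  assumes "\<And>r. 0 < r \<Longrightarrow> r < 1 \<Longrightarrow> summable (\<lambda>n. fps_nth F n * r ^ n)"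
  shows "fps_conv_radius F \<ge> 1"
  unfolding fps_conv_radius_def using assms by (intro conv_radius_geI_ex') auto

lemma
  fixes F G :: "real fps"
  assumes F: "fps_conv_radius F \<ge> 1" and G: "fps_conv_radius G \<ge> 1"
  shows fps_conv_radius_add_ge_1: "fps_conv_radius (F + G) \<ge> 1"
    and fps_conv_radius_diff_ge_1: "fps_conv_radius (F - G) \<ge> 1"
    and fps_conv_radius_mult_ge_1: "fps_conv_radius (F * G) \<ge> 1"
    and eval_fps_add_unit_disc: "\<bar>x\<bar> < 1 \<Longrightarrow> eval_fps (F + G) x = eval_fps F x + eval_fps G x"
    and eval_fps_diff_unit_disc: "\<bar>x\<bar> < 1 \<Longrightarrow> eval_fps (F - G) x = eval_fps F x - eval_fps G x"
    and eval_fps_mult_unit_disc: "\<bar>x\<bar> < 1 \<Longrightarrow> eval_fps (F * G) x = eval_fps F x * eval_fps G x"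
proof -
  have le: "1 \<le> min (fps_conv_radius F) (fps_conv_radius G)"
    using F G by simp
  show "fps_conv_radius (F + G) \<ge> 1" "fps_conv_radius (F - G) \<ge> 1" "fps_conv_radius (F * G) \<ge> 1"
    using order_trans[OF le fps_conv_radius_add] order_trans[OF le fps_conv_radius_diff]
      order_trans[OF le fps_conv_radius_mult] by auto
  assume "\<bar>x\<bar> < 1"
  then have "ereal (norm x) < 1"
    by simp
  then have "ereal (norm x) < fps_conv_radius F" "ereal (norm x) < fps_conv_radius G"
    using F G by (blast intro: order.strict_trans2)+
  then show "eval_fps (F + G) x = eval_fps F x + eval_fps G x"
    "eval_fps (F - G) x = eval_fps F x - eval_fps G x"
    "eval_fps (F * G) x = eval_fps F x * eval_fps G x"
    by (rule eval_fps_add eval_fps_diff eval_fps_mult; assumption)+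
qed

section \<open>The probability generating function\<close>

context prob_space
begin

lemma discrete_ML_pgf_open_disc:
  fixes T :: "'a \<Rightarrow> nat" and l q z :: real
  assumes l: "0 < l" "l < 1" and q: "0 < q" and T: "discrete_ML_distributed q l T" and z: "\<bar>z\<bar> < 1"
  shows "expectation (\<lambda>\<omega>. z ^ T \<omega>) = l * z / ((1 - z) powr q + l)"
proof -
  define p where "p t = prob {\<omega> \<in> space M. T \<omega> > t}" for t
  have T1: "random_variable (count_space {1..}) T"
    and p_Suc: "\<And>n. p (Suc n) = discrete_ML q (- l) (real (Suc n))"
    using T by (auto simp: discrete_ML_distributed_def p_def)
  have T2: "random_variable (count_space UNIV) T"
    using T1 by (rule measurable_count_space_mono) simp
  \<comment> \<open>The tail at 0 comes from the range of \<open>T\<close>, as the Mittag-Leffler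
    formula starts at 1.\<close>
  have "{\<omega> \<in> space M. T \<omega> > 0} = space M"
    using measurable_space[OF T1] by fastforce
  then have p_0: "p 0 = 1"
    by (simp add: p_def prob_space)

  \<comment> \<open>\<open>S\<close> generates the tails, \<open>B\<close> expands
    \<open>(1 - x) powr q\<close>, \<open>G\<close> is the generating function of \<open>T\<close>
    and \<open>H\<close> the denominator. \<open>F = 0\<close> is the claim with the denominator
    cleared, so no quotient of series arises.\<close>
  define S where "S = Abs_fps p"
  define B where "B = Abs_fps (\<lambda>n. (q gchoose n) * (- 1) ^ n)"
  define G where "G = 1 - (1 - fps_X) * S"
  define H where "H = B + fps_const l"
  define F where "F = G * H - fps_const l * fps_X"

  have B_sums: "(\<lambda>n. fps_nth B n * x ^ n) sums (1 - x) powr q" if "\<bar>x\<bar> < 1" for x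
    using gen_binomial_real[of "- x" q] that
    by (simp add: B_def mult.assoc flip: power_mult_distrib)
  have radius_S: "fps_conv_radius S \<ge> 1"
  proof (rule fps_conv_radius_ge_1I)
    fix r :: real assume "0 < r" "r < 1"
    then show "summable (\<lambda>n. fps_nth S n * r ^ n)"
      by (intro summable_comparison_test[OF _ summable_geometric[of r]] exI[of _ 0])
        (auto simp: S_def p_def abs_mult mult_left_le_one_le)
  qed
  have radius_B: "fps_conv_radius B \<ge> 1"
    using B_sums by (intro fps_conv_radius_ge_1I) (auto simp: sums_iff)
  note radius = fps_conv_radius_add_ge_1 fps_conv_radius_diff_ge_1 fps_conv_radius_mult_ge_1
    radius_S radius_B
  have eval_F: "eval_fps F x = (1 - (1 - x) * eval_fps S x) * ((1 - x) powr q + l) - l * x"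
    if "\<bar>x\<bar> < 1" for x
  proof -
    have "eval_fps B x = (1 - x) powr q"
      using B_sums[OF that] by (simp add: eval_fps_def sums_iff)
    then show ?thesis
      unfolding F_def G_def H_def using that
      by (simp add: eval_fps_add_unit_disc eval_fps_diff_unit_disc eval_fps_mult_unit_disc radius)
  qed

  have near_0: "eval_fps F x = 0" if x: "\<bar>x\<bar> < 1" and small: "l < (1 - \<bar>x\<bar>) powr q" for x
  proof -
    let ?u = "(1 - x) powr q"
    have "(\<lambda>n. p (Suc n) * x ^ n) sums ((1 - x) powr (q - 1) / (?u + l))"
      unfolding p_Suc using discrete_ML_generating_function[OF q x] small l(1) by simp
    \<comment> \<open>The known series starts at \<open>p 1\<close>; a factor \<open>x\<close>
      shifts it, and \<open>p 0 = 1\<close> is put in front.\<close>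
    from sums_mult2[OF this, of x]
    have "(\<lambda>n. p (Suc n) * x ^ Suc n) sums ((1 - x) powr (q - 1) / (?u + l) * x)"
      by (simp add: mult_ac)
    from sums_Suc[OF this]
    have "eval_fps S x = (1 - x) powr (q - 1) / (?u + l) * x + 1"
      by (simp add: eval_fps_def S_def sums_iff p_0)
    moreover have "(1 - x) powr (q - 1) = ?u / (1 - x)"
      using x by (simp add: powr_diff)
    moreover have "?u + l > 0"
      using l by (intro add_nonneg_pos) auto
    ultimately show ?thesis
      unfolding eval_F[OF x] using x by (simp add: divide_simps) (simp add: algebra_simps)
  qed
  \<comment> \<open>At 0 the bound equals 1, which exceeds \<open>l\<close>; continuity provides a
    whole neighbourhood.\<close>
  have "((\<lambda>x. (1 - \<bar>x\<bar>) powr q) \<longlongrightarrow> (1 - \<bar>0\<bar>) powr q) (nhds (0 :: real))"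
    by (intro tendsto_intros filterlim_ident) auto
  then have "eventually (\<lambda>x. l < (1 - \<bar>x\<bar>) powr q) (nhds 0)"
    using l(2) by (intro order_tendstoD(1)) auto
  moreover have "eventually (\<lambda>x :: real. \<bar>x\<bar> < 1) (nhds 0)"
    by (auto simp: eventually_nhds_metric dist_real_def intro!: exI[of _ 1])
  ultimately have "eventually (\<lambda>x. eval_fps F x = 0) (nhds 0)"
    by eventually_elim (rule near_0)
  moreover have "fps_conv_radius F \<ge> 1"
    by (simp add: F_def G_def H_def radius)
  ultimately have "F = 0"
    by (intro has_fps_expansion_zero_imp_eq_0)
      (auto simp: has_fps_expansion_def intro: order.strict_trans2[of _ 1])
  then have "(1 - (1 - z) * eval_fps S z) * ((1 - z) powr q + l) = l * z"
    using eval_F[OF z] by simp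
  moreover have "expectation (\<lambda>\<omega>. z ^ T \<omega>) = 1 - (1 - z) * eval_fps S z"
    using expectation_power_eq_tail_sum[OF T2 z] by (simp add: S_def eval_fps_def p_def)
  moreover have "(1 - z) powr q + l > 0"
    using l by (intro add_nonneg_pos) auto
  ultimately show ?thesis
    by (simp add: eq_divide_eq)
qed

text \<open>Dominated convergence with the constant majorant 1; it carries the formula to the
  endpoint -1.\<close>

lemma tendsto_expectation_power:
  fixes T :: "'a \<Rightarrow> nat" and x :: "nat \<Rightarrow> real"
  assumes [measurable]: "random_variable (count_space UNIV) T"
    and "x \<longlonglongrightarrow> y" and "\<And>n. \<bar>x n\<bar> \<le> 1"
  shows "(\<lambda>n. expectation (\<lambda>\<omega>. x n ^ T \<omega>)) \<longlonglongrightarrow> expectation (\<lambda>\<omega>. y ^ T \<omega>)"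
proof (rule integral_dominated_convergence)
  show "AE \<omega> in M. (\<lambda>n. x n ^ T \<omega>) \<longlonglongrightarrow> y ^ T \<omega>"
    using assms(2) by (intro AE_I2 tendsto_intros)
  show "AE \<omega> in M. norm (x n ^ T \<omega>) \<le> 1" for n
    using assms(3) by (intro AE_I2) (simp add: power_abs power_le_one)
qed auto

end

theorem theorem1:
  fixes M :: "'a measure" and T :: "'a \<Rightarrow> nat" and l q z :: real
  assumes "prob_space M"
    and "0 < l" and "l < 1"
    and "0 < q" and "q \<le> 1"
    and "prob_space.discrete_ML_distributed M q l T"
    and "-1 \<le> z" and "z \<le> 1"
  shows "prob_space.expectation M (\<lambda>\<omega>. z ^ T \<omega>) = l * z / ((1 - z) powr q + l)"
proof -
  interpret prob_space M by fact
  consider "\<bar>z\<bar> < 1" | "z = 1" | "z = -1"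
    using assms by linarith
  then show ?thesis
  proof cases
    case 1
    then show ?thesis
      using assms by (intro discrete_ML_pgf_open_disc)
  next
    \<comment> \<open>Since \<open>0 powr q = 0\<close>, both sides equal 1.\<close>
    case 2
    then show ?thesis
      using assms by (simp add: prob_space)
  next
    case 3
    \<comment> \<open>The points start at 0 and decrease to -1, staying inside the open
      interval.\<close>
    define x where "x n = - 1 + inverse (real (Suc n))" for n
    have x_lt: "\<bar>x n\<bar> < 1" for n
      by (auto simp: x_def abs_less_iff field_simps)
    have x_lim: "x \<longlonglongrightarrow> z"
      unfolding x_def 3 by (rule LIMSEQ_inverse_real_of_nat_add)
    have "random_variable (count_space UNIV) T"
      using assms(6) by (auto simp: discrete_ML_distributed_def intro: measurable_count_space_mono)
    then have "(\<lambda>n. expectation (\<lambda>\<omega>. x n ^ T \<omega>)) \<longlonglongrightarrow> expectation (\<lambda>\<omega>. z ^ T \<omega>)"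
      using x_lim x_lt by (intro tendsto_expectation_power) (auto intro: less_imp_le)
    then have "(\<lambda>n. l * x n / ((1 - x n) powr q + l)) \<longlonglongrightarrow> expectation (\<lambda>\<omega>. z ^ T \<omega>)"
      using discrete_ML_pgf_open_disc[OF assms(2,3,4,6) x_lt] by simp
    moreover have "(1 - z) powr q + l > 0"
      using assms(2) by (intro add_nonneg_pos) auto
    then have "(\<lambda>n. l * x n / ((1 - x n) powr q + l)) \<longlonglongrightarrow> l * z / ((1 - z) powr q + l)"
      using 3 by (intro tendsto_intros x_lim) auto
    ultimately show ?thesis
      by (rule LIMSEQ_unique)
  qed
qed

end
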